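(* If PASA with $\epsilon=0$ generates an infinite sequence of iterates $x_k$ that converge to a nondegenerate stationary point $x^*$ of the problem $\min\{f(x):x\in\Omega\}$, then within a finite number of iterations only phase two is executed (that is, there is $K$ such that all iterations with $k\ge K$ are phase-two iterations).
   Context: Problem: $\min\{f(x): x\in\Omega\}$, $\Omega=\{x\in\mathbb{R}^n: Ax\le b\}$, where $f:\mathbb{R}^n\to\mathbb{R}$ is continuously differentiable, $A\in\mathbb{R}^{m\times n}$, $b\in\mathbb{R}^m$, and $\Omega\neq\emptyset$. A stationary point is $x^*\in\Omega$ with $\nabla f(x^* )(x-x^* )\ge 0$ for all $x\in\Omega$. Notation: $\|\cdot\|$ is the Euclidean norm; $\nabla f(x)$ is a row vector and $g(x)=\nabla f(x)^{T}$; $\mathcal{P}_{\mathcal{S}}$ is Euclidean projection onto a closed convex set $\mathcal{S}$; $\mathcal{N}(M)$ is the null space of $M$; $A_{\mathcal{I}}$ is the submatrix of $A$ with rows indexed by $\mathcal{I}$. For $x\in\Omega$: $\mathcal{A}(x)=\{i:(Ax-b)_i=0\}$, $\mathcal{F}(x)=\{i:(Ax-b)_i<0\}$. For $\alpha\ge0$: $y(x,\alpha)=\mathcal{P}_\Omega(x-\alpha g(x))$ and $d^\alpha(x)=y(x,\alpha)-x$. $E(x)=\|d^1(x)\|$. $g^{\mathcal{A}}(x)=\mathcal{P}_{\mathcal{N}(A_{\mathcal{I}})}(g(x))$ with $\mathcal{I}=\mathcal{A}(x)$ (equal to $g(x)$ if $\mathcal{A}(x)=\emptyset$), and $e(x)=\|g^{\mathcal{A}}(x)\|$.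 For a stationary point $x^*$, $\Lambda(x^* )$ is the set of Lagrange multipliers: $\lambda\in\mathbb{R}^m$ with $g(x^* )+A^{T}\lambda=0$, $\lambda\ge0$, $\lambda_i=0$ for $i\in\mathcal{F}(x^* )$. The stationary point $x^*$ is nondegenerate if there is a scalar $\pi>0$ such that $\lambda_i>\pi$ for all $i\in\mathcal{A}(x^* )$ and all $\lambda\in\Lambda(x^* )$. Undecided index set: $\lambda(x)\in\mathbb{R}^m$ is any vector satisfying, with $y=y(x,1)$, $y-x+g(x)+A^{T}\lambda(x)=0$, $\lambda(x)\ge0$, $\lambda_i(x)=0$ for $i\in\mathcal{F}(y)$. Given $\beta\in(1,2)$, $\gamma\in(0,1)$, $\mathcal{U}(x)=\{i:\lambda_i(x)\ge E(x)^\gamma \text{ and } (b-Ax)_i\ge E(x)^\beta\}$. GPA iteration (parameters $\delta,\eta\in(0,1)$, $\alpha\in(0,\infty)$): $d_k=y(x_k,\alpha)-x_k$; $s_k=\eta^j$ where $j\ge0$ is the smallest integer with $f(x_k+s_kd_k)\le f(x_k)+s_k\delta\nabla f(x_k)d_k$; $x_{k+1}=x_k+s_kd_k$, $k\leftarrow k+1$. LCO is any iterative method, producing $x_{k+1}$ from $x_k$ in phase two, such that on phase-two iterations: (F1) $x_k\in\Omega$ and $f(x_{k+1})\le f(x_k)$ for each $k$; (F2) $\mathcal{A}(x_k)\subset\mathcal{A}(x_{k+1})$ for each $k$; (F3) if (phase two continues indefinitely and) $\mathcal{A}(x_{j+1})=\mathcal{A}(x_j)$ for all $j\ge k$, then $\liminf_{j\to\infty}e(x_j)=0$.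 PASA (parameters $\epsilon\in[0,\infty)$; initial $\theta\in(0,1)$; $\mu\in(0,1)$; starting guess $x_0\in\mathbb{R}^n$): set $x_1=\mathcal{P}_\Omega(x_0)$, $k=1$, and start in phase one. Phase one: while $E(x_k)>\epsilon$, execute a GPA iteration, and then, at the current iterate $x_k$: if $\mathcal{U}(x_k)=\emptyset$ and $e(x_k)<\theta E(x_k)$, set $\theta\leftarrow\mu\theta$; if $e(x_k)\ge\theta E(x_k)$, go to phase two. Phase two: while $E(x_k)>\epsilon$, execute an LCO iteration, and then, at the current iterate $x_k$: if $e(x_k)<\theta E(x_k)$, go to phase one. PASA terminates when $E(x_k)\le\epsilon$. *)

theory Defs
  imports "HOL-Analysis.Analysis"
begin

text \<open>
  Throughout, \<open>g x\<close> stands for the gradient of the objective \<open>f\<close> at \<open>x\<close> (tied to \<open>f\<close> in the theorem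
  by \<open>GDERIV f x :> g x\<close>), so the row-vector product of the gradient with \<open>d\<close> is \<open>g x \<bullet> d\<close>.
  Euclidean projection is the library's \<^const>\<open>closest_point\<close>.
\<close>

definition feasible :: "real^'n^'m \<Rightarrow> real^'m \<Rightarrow> (real^'n) set" where
  "feasible A b = {x. \<forall>i. (A *v x) $ i \<le> b $ i}"

definition active :: "real^'n^'m \<Rightarrow> real^'m \<Rightarrow> real^'n \<Rightarrow> 'm set" where
  "active A b x = {i. (A *v x - b) $ i = 0}"

definition inactive :: "real^'n^'m \<Rightarrow> real^'m \<Rightarrow> real^'n \<Rightarrow> 'm set" where
  "inactive A b x = {i. (A *v x - b) $ i < 0}"

definition stationary ::
  "(real^'n \<Rightarrow> real^'n) \<Rightarrow> real^'n^'m \<Rightarrow> real^'m \<Rightarrow> real^'n \<Rightarrow> bool" where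
  "stationary g A b xs \<longleftrightarrow>
     xs \<in> feasible A b \<and> (\<forall>x \<in> feasible A b. g xs \<bullet> (x - xs) \<ge> 0)"

definition multipliers ::
  "(real^'n \<Rightarrow> real^'n) \<Rightarrow> real^'n^'m \<Rightarrow> real^'m \<Rightarrow> real^'n \<Rightarrow> (real^'m) set" where
  "multipliers g A b xs =
     {l. g xs + transpose A *v l = 0 \<and> (\<forall>i. l $ i \<ge> 0) \<and> (\<forall>i \<in> inactive A b xs. l $ i = 0)}"

definition nondegenerate ::
  "(real^'n \<Rightarrow> real^'n) \<Rightarrow> real^'n^'m \<Rightarrow> real^'m \<Rightarrow> real^'n \<Rightarrow> bool" where
  "nondegenerate g A b xs \<longleftrightarrow>
     (\<exists>\<pi>>0. \<forall>i \<in> active A b xs. \<forall>l \<in> multipliers g A b xs. l $ i > \<pi>)"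

definition gp_point ::
  "(real^'n \<Rightarrow> real^'n) \<Rightarrow> real^'n^'m \<Rightarrow> real^'m \<Rightarrow> real^'n \<Rightarrow> real \<Rightarrow> real^'n" where
  "gp_point g A b x \<alpha> = closest_point (feasible A b) (x - \<alpha> *\<^sub>R g x)"

definition gp_dir ::
  "(real^'n \<Rightarrow> real^'n) \<Rightarrow> real^'n^'m \<Rightarrow> real^'m \<Rightarrow> real \<Rightarrow> real^'n \<Rightarrow> real^'n" where
  "gp_dir g A b \<alpha> x = gp_point g A b x \<alpha> - x"

definition global_err ::
  "(real^'n \<Rightarrow> real^'n) \<Rightarrow> real^'n^'m \<Rightarrow> real^'m \<Rightarrow> real^'n \<Rightarrow> real" where
  "global_err g A b x = norm (gp_dir g A b 1 x)"

text \<open>The null space of the submatrix of \<open>A\<close> with rows \<open>I\<close>; it is \<^const>\<open>UNIV\<close> for \<open>I = {}\<close>.\<close>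

definition rows_null_space :: "real^'n^'m \<Rightarrow> 'm set \<Rightarrow> (real^'n) set" where
  "rows_null_space A I = {v. \<forall>i \<in> I. (A *v v) $ i = 0}"

definition active_grad ::
  "(real^'n \<Rightarrow> real^'n) \<Rightarrow> real^'n^'m \<Rightarrow> real^'m \<Rightarrow> real^'n \<Rightarrow> real^'n" where
  "active_grad g A b x = closest_point (rows_null_space A (active A b x)) (g x)"

lemma active_grad_no_active: "active A b x = {} \<Longrightarrow> active_grad g A b x = g x"
  by (simp add: active_grad_def rows_null_space_def closest_point_self)

definition local_err ::
  "(real^'n \<Rightarrow> real^'n) \<Rightarrow> real^'n^'m \<Rightarrow> real^'m \<Rightarrow> real^'n \<Rightarrow> real" where
  "local_err g A b x = norm (active_grad g A b x)"

text \<open>\<open>lam\<close> selects, at each feasible \<open>x\<close>, some multiplier of the projection problem defining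
  \<open>y(x,1)\<close>; such a multiplier need not be unique.\<close>

definition multiplier_selection ::
  "(real^'n \<Rightarrow> real^'n) \<Rightarrow> real^'n^'m \<Rightarrow> real^'m \<Rightarrow> (real^'n \<Rightarrow> real^'m) \<Rightarrow> bool" where
  "multiplier_selection g A b lam \<longleftrightarrow>
     (\<forall>x \<in> feasible A b.
        gp_point g A b x 1 - x + g x + transpose A *v lam x = 0 \<and>
        (\<forall>i. lam x $ i \<ge> 0) \<and>
        (\<forall>i \<in> inactive A b (gp_point g A b x 1). lam x $ i = 0))"

definition undecided ::
  "(real^'n \<Rightarrow> real^'n) \<Rightarrow> real^'n^'m \<Rightarrow> real^'m \<Rightarrow> (real^'n \<Rightarrow> real^'m) \<Rightarrow> real \<Rightarrow> real \<Rightarrow>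
   real^'n \<Rightarrow> 'm set" where
  "undecided g A b lam \<beta> \<gamma> x =
     {i. lam x $ i \<ge> global_err g A b x powr \<gamma> \<and>
         (b - A *v x) $ i \<ge> global_err g A b x powr \<beta>}"

definition armijo ::
  "(real^'n \<Rightarrow> real) \<Rightarrow> (real^'n \<Rightarrow> real^'n) \<Rightarrow> real \<Rightarrow> real^'n \<Rightarrow> real^'n \<Rightarrow> real \<Rightarrow> bool" where
  "armijo f g \<delta> x d s \<longleftrightarrow> f (x + s *\<^sub>R d) \<le> f x + s * \<delta> * (g x \<bullet> d)"

definition gpa_step ::
  "(real^'n \<Rightarrow> real) \<Rightarrow> (real^'n \<Rightarrow> real^'n) \<Rightarrow> real^'n^'m \<Rightarrow> real^'m \<Rightarrow>
   real \<Rightarrow> real \<Rightarrow> real \<Rightarrow> real^'n \<Rightarrow> real^'n \<Rightarrow> bool" where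
  "gpa_step f g A b \<delta> \<eta> \<alpha> x x' \<longleftrightarrow>
     (\<exists>j::nat. armijo f g \<delta> x (gp_dir g A b \<alpha> x) (\<eta> ^ j) \<and>
        (\<forall>i<j. \<not> armijo f g \<delta> x (gp_dir g A b \<alpha> x) (\<eta> ^ i)) \<and>
        x' = x + (\<eta> ^ j) *\<^sub>R gp_dir g A b \<alpha> x)"

text \<open>
  A run is a sequence of iterates \<open>x\<close> together with \<open>\<theta>\<close> and \<open>ph\<close>: for \<open>k \<ge> 1\<close>, \<open>ph k\<close> is the phase
  in which the iteration from \<open>x k\<close> to \<open>x (Suc k)\<close> is executed, and \<open>\<theta> k\<close> is the value of the
  parameter at the start of that iteration. Iterates are numbered from 1; \<open>x 0\<close> is the (possibly
  infeasible) starting guess.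
\<close>

datatype phase = Phase_One | Phase_Two

text \<open>
  The requirements F1--F3 on the linearly constrained optimizer, imposed on the run it takes part
  in. F1 asks for feasibility of all iterates of a stretch of phase two, including the last one
  produced.
\<close>

definition lco_F1 ::
  "(real^'n \<Rightarrow> real) \<Rightarrow> real^'n^'m \<Rightarrow> real^'m \<Rightarrow> (nat \<Rightarrow> real^'n) \<Rightarrow> (nat \<Rightarrow> phase) \<Rightarrow> bool" where
  "lco_F1 f A b x ph \<longleftrightarrow>
     (\<forall>k\<ge>1. ph k = Phase_Two \<longrightarrow>
        x k \<in> feasible A b \<and> x (Suc k) \<in> feasible A b \<and> f (x (Suc k)) \<le> f (x k))"

definition lco_F2 ::
  "real^'n^'m \<Rightarrow> real^'m \<Rightarrow> (nat \<Rightarrow> real^'n) \<Rightarrow> (nat \<Rightarrow> phase) \<Rightarrow> bool" where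
  "lco_F2 A b x ph \<longleftrightarrow>
     (\<forall>k\<ge>1. ph k = Phase_Two \<longrightarrow> active A b (x k) \<subseteq> active A b (x (Suc k)))"

definition lco_F3 ::
  "(real^'n \<Rightarrow> real^'n) \<Rightarrow> real^'n^'m \<Rightarrow> real^'m \<Rightarrow> (nat \<Rightarrow> real^'n) \<Rightarrow> (nat \<Rightarrow> phase) \<Rightarrow> bool" where
  "lco_F3 g A b x ph \<longleftrightarrow>
     (\<forall>k\<ge>1. (\<forall>j\<ge>k. ph j = Phase_Two \<and> active A b (x (Suc j)) = active A b (x j)) \<longrightarrow>
        liminf (\<lambda>j. ereal (local_err g A b (x j))) = 0)"

text \<open>
  One pass through the loop body in either phase. In phase one the update of \<open>\<theta>\<close> precedes the test
  for leaving the phase, which therefore uses the updated value.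
\<close>

definition phase_one_iteration ::
  "(real^'n \<Rightarrow> real) \<Rightarrow> (real^'n \<Rightarrow> real^'n) \<Rightarrow> real^'n^'m \<Rightarrow> real^'m \<Rightarrow> (real^'n \<Rightarrow> real^'m) \<Rightarrow>
   real \<Rightarrow> real \<Rightarrow> real \<Rightarrow> real \<Rightarrow> real \<Rightarrow> real \<Rightarrow>
   real^'n \<Rightarrow> real \<Rightarrow> real^'n \<Rightarrow> real \<Rightarrow> phase \<Rightarrow> bool" where
  "phase_one_iteration f g A b lam \<delta> \<eta> \<alpha> \<beta> \<gamma> \<mu> x \<theta> x' \<theta>' ph' \<longleftrightarrow>
     gpa_step f g A b \<delta> \<eta> \<alpha> x x' \<and>
     \<theta>' = (if undecided g A b lam \<beta> \<gamma> x' = {} \<and> local_err g A b x' < \<theta> * global_err g A b x'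
           then \<mu> * \<theta> else \<theta>) \<and>
     ph' = (if local_err g A b x' \<ge> \<theta>' * global_err g A b x' then Phase_Two else Phase_One)"

definition phase_two_control ::
  "(real^'n \<Rightarrow> real^'n) \<Rightarrow> real^'n^'m \<Rightarrow> real^'m \<Rightarrow>
   real \<Rightarrow> real^'n \<Rightarrow> real \<Rightarrow> phase \<Rightarrow> bool" where
  "phase_two_control g A b \<theta> x' \<theta>' ph' \<longleftrightarrow>
     \<theta>' = \<theta> \<and>
     ph' = (if local_err g A b x' < \<theta> * global_err g A b x' then Phase_One else Phase_Two)"

text \<open>
  A run of PASA that never terminates: the loop guard \<open>E(x\<^sub>k) > \<epsilon>\<close> holds at every \<open>k\<close>. The step of
  the optimizer in phase two is constrained only by F1--F3, so it may be any method, possibly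
  one with memory.
\<close>

definition pasa_infinite_run ::
  "(real^'n \<Rightarrow> real) \<Rightarrow> (real^'n \<Rightarrow> real^'n) \<Rightarrow> real^'n^'m \<Rightarrow> real^'m \<Rightarrow> (real^'n \<Rightarrow> real^'m) \<Rightarrow>
   real \<Rightarrow> real \<Rightarrow> real \<Rightarrow> real \<Rightarrow> real \<Rightarrow> real \<Rightarrow> real \<Rightarrow> real \<Rightarrow>
   (nat \<Rightarrow> real^'n) \<Rightarrow> (nat \<Rightarrow> real) \<Rightarrow> (nat \<Rightarrow> phase) \<Rightarrow> bool" where
  "pasa_infinite_run f g A b lam \<delta> \<eta> \<alpha> \<beta> \<gamma> \<mu> \<epsilon> \<theta>0 x \<theta> ph \<longleftrightarrow>
     x 1 = closest_point (feasible A b) (x 0) \<and> \<theta> 1 = \<theta>0 \<and> ph 1 = Phase_One \<and>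
     (\<forall>k\<ge>1. global_err g A b (x k) > \<epsilon>) \<and>
     (\<forall>k\<ge>1. ph k = Phase_One \<longrightarrow>
        phase_one_iteration f g A b lam \<delta> \<eta> \<alpha> \<beta> \<gamma> \<mu>
          (x k) (\<theta> k) (x (Suc k)) (\<theta> (Suc k)) (ph (Suc k))) \<and>
     (\<forall>k\<ge>1. ph k = Phase_Two \<longrightarrow>
        phase_two_control g A b (\<theta> k) (x (Suc k)) (\<theta> (Suc k)) (ph (Suc k))) \<and>
     lco_F1 f A b x ph \<and> lco_F2 A b x ph \<and> lco_F3 g A b x ph"

end

theory Submission
  imports Defs
begin

text \<open>
  Let \<open>I\<close> be the set of constraints active at the limit \<open>xs\<close>, let \<open>N\<close> be the null space of the rows in
  \<open>I\<close>, let \<open>S x\<close> be the total slack of the constraints in \<open>I\<close> at \<open>x\<close>, and let \<open>t x\<close> be the norm of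
  the orthogonal projection of \<open>g x\<close> onto \<open>N\<close>. Write \<open>e\<close> for \<^const>\<open>local_err\<close> and \<open>E\<close> for
  \<^const>\<open>global_err\<close>. The face in question is the set of feasible points at which all constraints in
  \<open>I\<close> hold with equality. One phase-one step taken close enough to \<open>xs\<close> lands on this face, and from
  there the algorithm never returns to phase one.

  The multiplier selection, evaluated at \<open>xs\<close> itself, is a Lagrange multiplier of \<open>xs\<close>, and
  nondegeneracy makes its components on \<open>I\<close> at least some \<open>c > 0\<close>. Hence moving off the face costs
  at first order at least \<open>c\<close> times the slack created. Consequently, for \<open>x\<close> near \<open>xs\<close>, the gradient
  projection point of \<open>x\<close> has exactly the active set \<open>I\<close> (\<open>eventually_gp_point_active\<close>). The search
  direction \<open>d\<close> therefore splits into a component in \<open>N\<close>, which is \<open>- \<alpha>\<close> times the projected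
  gradient, and a component orthogonal to \<open>N\<close>, which closes the slacks and has norm at most a
  constant times \<open>S x\<close> (\<open>norm_gp_dir_le\<close>).

  A phase-one iterate after the first satisfies \<open>e x < \<theta> E x\<close> with \<open>\<theta> \<le> \<theta>0 < 1\<close>. Near \<open>xs\<close>
  one has \<open>t x \<le> e x\<close> and \<open>E x \<le> C S x + t x\<close>, so \<open>t x\<close>, and with it the norm of \<open>d\<close>, is bounded by
  a multiple of \<open>S x\<close> (\<open>eventually_gp_dir_le_slack\<close>). Since \<open>d\<close> closes all the slacks, it decreases
  \<open>f\<close> at a rate of at least \<open>c S x\<close>, whereas the linearization error of \<open>f\<close> is small compared with
  the norm of \<open>d\<close>, hence with \<open>S x\<close>. So the unit step passes the line search
  (\<open>eventually_full_step\<close>), and the next iterate is the gradient projection point, which lies on the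
  face.

  At a point near \<open>xs\<close> with active set \<open>I\<close> the slack vanishes and \<open>E x \<le> e x\<close>; as \<open>E x > 0\<close> and
  \<open>\<theta> < 1\<close>, the phase tests choose phase two. Phase two keeps active constraints active, and near
  \<open>xs\<close> no constraint outside \<open>I\<close> can become active, so the active set remains \<open>I\<close> forever.
\<close>

section \<open>Orthogonal projection onto a subspace\<close>

lemma closest_point_subspace_orthogonal:
  fixes S :: "'a::euclidean_space set"
  assumes S: "subspace S" and v: "v \<in> S"
  shows "(z - closest_point S z) \<bullet> v = 0"
proof -
  let ?p = "closest_point S z"
  have cc: "convex S" "closed S" using S by (simp_all add: subspace_imp_convex closed_subspace)
  have p: "?p \<in> S" using closest_point_in_set[OF cc(2)] v by auto
  have "(z - ?p) \<bullet> ((?p + v) - ?p) \<le> 0"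
    by (rule closest_point_dot[OF cc]) (use S p v in \<open>simp add: subspace_add\<close>)
  moreover have "(z - ?p) \<bullet> ((?p - v) - ?p) \<le> 0"
    by (rule closest_point_dot[OF cc]) (use S p v in \<open>simp add: subspace_diff\<close>)
  ultimately show ?thesis by simp
qed

lemma closest_point_subspace_unique:
  fixes S :: "'a::euclidean_space set"
  assumes S: "subspace S" and p: "p \<in> S" and orth: "\<And>v. v \<in> S \<Longrightarrow> (z - p) \<bullet> v = 0"
  shows "closest_point S z = p"
proof -
  let ?q = "closest_point S z"
  have q: "?q \<in> S" using closest_point_in_set[OF closed_subspace[OF S]] p by auto
  have d: "?q - p \<in> S" using S p q by (simp add: subspace_diff)
  have "(?q - p) \<bullet> (?q - p) = (z - p) \<bullet> (?q - p) - (z - ?q) \<bullet> (?q - p)"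
    by (simp add: algebra_simps)
  then show ?thesis
    using orth[OF d] closest_point_subspace_orthogonal[OF S d] by simp
qed

text \<open>
  With \<open>p\<close> and \<open>q\<close> the projections onto \<open>S\<close> and \<open>T\<close>, both residuals are orthogonal to \<open>p \<in> S \<subseteq> T\<close>,
  so \<open>p \<bullet> p = z \<bullet> p = q \<bullet> p\<close>, and Cauchy--Schwarz finishes.
\<close>

lemma norm_closest_point_subspace_mono:
  fixes S T :: "'a::euclidean_space set"
  assumes S: "subspace S" and T: "subspace T" and ST: "S \<subseteq> T"
  shows "norm (closest_point S z) \<le> norm (closest_point T z)"
proof -
  let ?p = "closest_point S z" and ?q = "closest_point T z"
  have p: "?p \<in> S"
    using closest_point_in_set[OF closed_subspace[OF S]] subspace_0[OF S] by blast
  have "(z - ?p) \<bullet> ?p = 0" "(z - ?q) \<bullet> ?p = 0"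
    using closest_point_subspace_orthogonal[OF S p] closest_point_subspace_orthogonal[OF T] p ST
    by auto
  then have "norm ?p * norm ?p = ?q \<bullet> ?p"
    by (simp add: inner_diff_left flip: power2_eq_square power2_norm_eq_inner)
  also have "\<dots> \<le> norm ?q * norm ?p" by (rule norm_cauchy_schwarz)
  finally show ?thesis
    by (cases "norm ?p = 0") (simp_all add: mult_le_cancel_right)
qed

section \<open>Polyhedra\<close>

lemma feasible_eq_INT: "feasible A b = (\<Inter>i. {x. (A *v x) $ i \<le> b $ i})"
  by (auto simp: feasible_def)

lemma continuous_on_matrix_component:
  fixes A :: "real^'n^'m"
  shows "continuous_on S (\<lambda>x. (A *v x) $ i)"
  by (intro continuous_intros linear_continuous_on matrix_vector_mul_bounded_linear)

lemma closed_feasible: "closed (feasible A b)"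
  unfolding feasible_eq_INT
  by (intro closed_INT ballI closed_Collect_le continuous_on_matrix_component continuous_on_const)

lemma convex_feasible: "convex (feasible A b)"
  unfolding feasible_eq_INT
proof (intro convex_INT)
  fix i
  have "{x. (A *v x) $ i \<le> b $ i} = {x. row i A \<bullet> x \<le> b $ i}"
    by (simp add: matrix_vector_mult_def row_def inner_vec_def)
  then show "convex {x. (A *v x) $ i \<le> b $ i}" by (simp add: convex_halfspace_le)
qed

lemma subspace_rows_null_space: "subspace (rows_null_space A I)"
  by (auto simp: subspace_def rows_null_space_def matrix_vector_right_distrib
      matrix_vector_mult_scaleR)

lemma active_feasible_iff: "x \<in> feasible A b \<Longrightarrow> i \<notin> active A b x \<longleftrightarrow> (A *v x) $ i < b $ i"
  by (auto simp: feasible_def active_def less_le)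

text \<open>
  On the orthogonal complement of the null space, the linear map that evaluates the rows in \<open>I\<close> is
  injective, hence bounded below. This linear error bound turns
  slacks of constraints into distances.
\<close>

lemma norm_le_rows_on_orthogonal_complement:
  fixes A :: "real^'n^'m"
  obtains C where "C > 0"
    "\<And>v. (\<And>u. u \<in> rows_null_space A I \<Longrightarrow> v \<bullet> u = 0) \<Longrightarrow> norm v \<le> C * (\<Sum>i\<in>I. \<bar>(A *v v) $ i\<bar>)"
proof -
  let ?N = "rows_null_space A I"
  let ?S = "{v. \<forall>u\<in>?N. v \<bullet> u = 0}"
  let ?F = "\<lambda>v::real^'n. (\<chi> i. if i \<in> I then (A *v v) $ i else 0) :: real^'m"
  have sub: "subspace ?S"
    by (auto simp: subspace_def inner_add_left)
  have "linear ?F"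
    by (rule linearI) (auto simp: vec_eq_iff matrix_vector_right_distrib matrix_vector_mult_scaleR)
  then have bl: "bounded_linear ?F" by (simp add: linear_conv_bounded_linear)
  have "\<forall>v\<in>?S. ?F v = 0 \<longrightarrow> v = 0"
  proof (intro ballI impI)
    fix v assume v: "v \<in> ?S" and Fv: "?F v = 0"
    have Fvi: "?F v $ i = 0" for i unfolding Fv by (rule zero_index)
    have "(A *v v) $ i = 0" if "i \<in> I" for i using Fvi[of i] that by simp
    then have "v \<in> ?N" by (simp add: rows_null_space_def)
    with v have "v \<bullet> v = 0" by blast
    then show "v = 0" by simp
  qed
  from injective_imp_isometric[OF closed_subspace[OF sub] sub bl this]
  obtain e where e: "e > 0" "\<And>v. v \<in> ?S \<Longrightarrow> norm (?F v) \<ge> e * norm v" by blast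
  have "norm v \<le> 1 / e * (\<Sum>i\<in>I. \<bar>(A *v v) $ i\<bar>)" if "\<And>u. u \<in> ?N \<Longrightarrow> v \<bullet> u = 0" for v
  proof -
    have "e * norm v \<le> norm (?F v)" using e(2) that by auto
    also have "\<dots> \<le> (\<Sum>i\<in>UNIV. \<bar>?F v $ i\<bar>)" by (rule norm_le_l1_cart)
    also have "\<dots> = (\<Sum>i\<in>I. \<bar>(A *v v) $ i\<bar>)"
      by (rule sum.mono_neutral_cong_right) auto
    finally show ?thesis using e(1) by (simp add: field_simps)
  qed
  with e(1) show ?thesis by (intro that[of "1/e"]) auto
qed

section \<open>The gradient projection point near a stationary point\<close>

lemma gp_point_feasible: "feasible A b \<noteq> {} \<Longrightarrow> gp_point g A b x \<alpha> \<in> feasible A b"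
  unfolding gp_point_def by (rule closest_point_in_set[OF closed_feasible])

lemma gp_point_variational:
  "z \<in> feasible A b \<Longrightarrow>
    (x - \<alpha> *\<^sub>R g x - gp_point g A b x \<alpha>) \<bullet> (z - gp_point g A b x \<alpha>) \<le> 0"
  unfolding gp_point_def by (rule closest_point_dot[OF convex_feasible closed_feasible])

text \<open>
  Comparing the variational inequality of the projection, tested with \<open>xs\<close>, with stationarity of
  \<open>xs\<close>, tested with the projection, leaves a nonpositive squared distance.
\<close>

lemma gp_point_stationary:
  assumes "stationary g A b xs" and "\<alpha> \<ge> 0"
  shows "gp_point g A b xs \<alpha> = xs"
proof -
  let ?y = "gp_point g A b xs \<alpha>"
  have xs: "xs \<in> feasible A b" using assms by (simp add: stationary_def)
  then have "?y \<in> feasible A b" using gp_point_feasible by blast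
  then have "\<alpha> * (g xs \<bullet> (?y - xs)) \<ge> 0" using assms by (simp add: stationary_def)
  moreover have "(xs - \<alpha> *\<^sub>R g xs - ?y) \<bullet> (xs - ?y) \<le> 0" by (rule gp_point_variational[OF xs])
  moreover have "(xs - \<alpha> *\<^sub>R g xs - ?y) \<bullet> (xs - ?y)
      = (xs - ?y) \<bullet> (xs - ?y) + \<alpha> * (g xs \<bullet> (?y - xs))"
    by (simp add: algebra_simps)
  ultimately have "(xs - ?y) \<bullet> (xs - ?y) \<le> 0" by linarith
  then have "xs - ?y = 0" by (metis inner_gt_zero_iff not_less)
  then show ?thesis by simp
qed

definition slack_sum :: "real^'n^'m \<Rightarrow> real^'m \<Rightarrow> 'm set \<Rightarrow> real^'n \<Rightarrow> real" where
  "slack_sum A b I x = (\<Sum>i\<in>I. b $ i - (A *v x) $ i)"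

text \<open>
  The local analysis rests on one multiplier \<open>l\<close> that is bounded away from zero on the active
  constraints: \<open>c\<close> is the rate at which \<open>f\<close> decreases per unit of slack closed.
\<close>

locale strictly_complementary_point =
  fixes g :: "real^'n \<Rightarrow> real^'n" and A :: "real^'n^'m" and b :: "real^'m"
    and xs :: "real^'n" and l :: "real^'m" and c :: real
  assumes cont: "continuous_on UNIV g"
    and stat: "stationary g A b xs"
    and mult: "l \<in> multipliers g A b xs"
    and c_pos: "c > 0"
    and c_le: "\<And>i. i \<in> active A b xs \<Longrightarrow> c \<le> l $ i"
begin

abbreviation "I \<equiv> active A b xs"
abbreviation "N \<equiv> rows_null_space A I"
abbreviation "S \<equiv> slack_sum A b I"

lemma xs_feasible: "xs \<in> feasible A b"
  using stat by (simp add: stationary_def)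

lemma active_row_at_xs: "i \<in> I \<Longrightarrow> (A *v xs) $ i = b $ i"
  by (simp add: active_def)

lemma closest_point_N_mem: "closest_point N z \<in> N"
  using closest_point_in_set[OF closed_subspace[OF subspace_rows_null_space]]
    subspace_0[OF subspace_rows_null_space] by blast

lemma slack_sum_nonneg: "x \<in> feasible A b \<Longrightarrow> S x \<ge> 0"
  unfolding slack_sum_def by (rule sum_nonneg) (simp add: feasible_def)

lemma slack_sum_eq_0_iff:
  assumes "x \<in> feasible A b"
  shows "S x = 0 \<longleftrightarrow> I \<subseteq> active A b x"
proof -
  have "S x = 0 \<longleftrightarrow> (\<forall>i\<in>I. b $ i - (A *v x) $ i = 0)"
    unfolding slack_sum_def by (rule sum_nonneg_eq_0_iff) (use assms in \<open>auto simp: feasible_def\<close>)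
  then show ?thesis by (auto simp: active_def)
qed

text \<open>
  Since \<open>g xs\<close> is minus the combination of the active rows with weights \<open>l\<close>, a direction that closes
  slacks of the active constraints is a descent direction, at a rate proportional to the slack closed.
\<close>

lemma grad_inner_le:
  assumes "\<And>i. i \<in> I \<Longrightarrow> (A *v v) $ i \<ge> 0"
  shows "g xs \<bullet> v \<le> - c * (\<Sum>i\<in>I. (A *v v) $ i)"
proof -
  have zero: "l $ i = 0" if "i \<notin> I" for i
    using mult that active_feasible_iff[OF xs_feasible] by (auto simp: multipliers_def inactive_def)
  have "g xs = - (l v* A)"
    using mult by (simp add: multipliers_def eq_neg_iff_add_eq_0)
  then have "g xs \<bullet> v = - (l \<bullet> (A *v v))" by (simp add: dot_lmul_matrix)
  also have "l \<bullet> (A *v v) = (\<Sum>i\<in>I. l $ i * (A *v v) $ i)"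
    unfolding inner_vec_def by (rule sum.mono_neutral_cong_right) (auto simp: zero)
  also have "- \<dots> \<le> - (\<Sum>i\<in>I. c * (A *v v) $ i)"
    using assms c_le by (intro le_imp_neg_le sum_mono mult_right_mono) auto
  finally show ?thesis by (simp flip: sum_distrib_left)
qed

lemma tendsto_g: "(g \<longlongrightarrow> g xs) (nhds xs)"
  using cont by (simp add: continuous_on_eq_continuous_within isCont_def tendsto_at_iff_tendsto_nhds)

lemma tendsto_gp_point:
  assumes "\<alpha> \<ge> 0"
  shows "((\<lambda>x. gp_point g A b x \<alpha>) \<longlongrightarrow> xs) (nhds xs)"
proof -
  have "isCont (closest_point (feasible A b)) (xs - \<alpha> *\<^sub>R g xs)"
    using xs_feasible by (intro continuous_at_closest_point convex_feasible closed_feasible) auto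
  then have "((\<lambda>x. gp_point g A b x \<alpha>) \<longlongrightarrow> gp_point g A b xs \<alpha>) (nhds xs)"
    unfolding gp_point_def
    by (rule isCont_tendsto_compose) (intro tendsto_intros tendsto_g filterlim_ident)
  then show ?thesis using gp_point_stationary[OF stat assms] by simp
qed

lemma eventually_inactive:
  assumes "(h \<longlongrightarrow> xs) F"
  shows "\<forall>\<^sub>F x in F. \<forall>i. i \<notin> I \<longrightarrow> (A *v h x) $ i < b $ i"
proof (rule eventually_all_finite)
  fix i
  show "\<forall>\<^sub>F x in F. i \<notin> I \<longrightarrow> (A *v h x) $ i < b $ i"
  proof (cases "i \<in> I")
    case False
    have "isCont (\<lambda>x. (A *v x) $ i) xs"
      using continuous_on_matrix_component[of UNIV A i]
      by (simp add: continuous_on_eq_continuous_within)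
    then have "((\<lambda>x. (A *v h x) $ i) \<longlongrightarrow> (A *v xs) $ i) F"
      by (rule isCont_tendsto_compose) (rule assms)
    then have "\<forall>\<^sub>F x in F. (A *v h x) $ i < b $ i"
      by (rule order_tendstoD) (use False active_feasible_iff[OF xs_feasible] in auto)
    then show ?thesis by eventually_elim simp
  qed simp
qed

lemma eventually_active_subset:
  assumes "(h \<longlongrightarrow> xs) F"
  shows "\<forall>\<^sub>F x in F. active A b (h x) \<subseteq> I"
  using eventually_inactive[OF assms]
  by eventually_elim (auto simp: active_def order_less_le)

text \<open>
  Identification of the active set. If the projection \<open>y\<close> had slack in some constraint of \<open>I\<close>, then
  moving from \<open>y\<close> orthogonally to \<open>N\<close> until all constraints of \<open>I\<close> are tight would give a feasible
  point \<open>y + u\<close>, where the error bound makes the norm of \<open>u\<close> at most a multiple of the slack. By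
  strict complementarity this move has an inner product with \<open>- \<alpha> g xs\<close> that is positive and
  proportional to the slack. The residual \<open>w\<close> of the projection is close to \<open>- \<alpha> g xs\<close>, so
  \<open>w \<bullet> u > 0\<close>, contradicting the variational inequality.
\<close>

lemma eventually_gp_point_active:
  assumes \<alpha>: "\<alpha> > 0"
  shows "\<forall>\<^sub>F x in nhds xs. active A b (gp_point g A b x \<alpha>) = I"
proof -
  let ?y = "\<lambda>x. gp_point g A b x \<alpha>"
  \<comment> \<open>The move \<open>u\<close> is the part of \<open>xs - y\<close> orthogonal to \<open>N\<close>; like \<open>xs - y\<close>, it makes the constraints
      in \<open>I\<close> tight, but it has norm of the order of the slack.\<close>
  let ?u = "\<lambda>x. (xs - ?y x) - closest_point N (xs - ?y x)"
  let ?w = "\<lambda>x. x - \<alpha> *\<^sub>R g x - ?y x"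
  obtain C where C: "C > 0"
    "\<And>v. (\<And>u. u \<in> N \<Longrightarrow> v \<bullet> u = 0) \<Longrightarrow> norm v \<le> C * (\<Sum>i\<in>I. \<bar>(A *v v) $ i\<bar>)"
    using norm_le_rows_on_orthogonal_complement[of A I] by blast
  have y: "(?y \<longlongrightarrow> xs) (nhds xs)" using \<alpha> by (intro tendsto_gp_point) simp
  have "N \<noteq> {}" using closest_point_N_mem by blast
  then have "isCont (closest_point N) 0"
    by (intro continuous_at_closest_point subspace_imp_convex closed_subspace
        subspace_rows_null_space)
  moreover have "((\<lambda>x. xs - ?y x) \<longlongrightarrow> 0) (nhds xs)"
    using tendsto_diff[OF tendsto_const[of xs] y] by simp
  ultimately have "((\<lambda>x. closest_point N (xs - ?y x)) \<longlongrightarrow> closest_point N 0) (nhds xs)"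
    by (rule isCont_tendsto_compose)
  moreover have "closest_point N 0 = 0"
    by (simp add: closest_point_self subspace_0 subspace_rows_null_space)
  ultimately have "((\<lambda>x. ?y x + ?u x) \<longlongrightarrow> xs + ((xs - xs) - 0)) (nhds xs)"
    by (intro tendsto_intros y) simp
  then have z: "((\<lambda>x. ?y x + ?u x) \<longlongrightarrow> xs) (nhds xs)" by simp
  have "(?w \<longlongrightarrow> xs - \<alpha> *\<^sub>R g xs - xs) (nhds xs)"
    by (intro tendsto_intros tendsto_g y filterlim_ident)
  then have w: "\<forall>\<^sub>F x in nhds xs. dist (?w x) (- \<alpha> *\<^sub>R g xs) < \<alpha> * c / C"
    using \<alpha> c_pos C(1) by (intro tendstoD) auto
  show ?thesis
    using eventually_inactive[OF z] w eventually_active_subset[OF y]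
  proof eventually_elim
    case (elim x)
    have yf: "?y x \<in> feasible A b" using gp_point_feasible xs_feasible by blast
    have Au: "(A *v ?u x) $ i = b $ i - (A *v ?y x) $ i" if "i \<in> I" for i
      using closest_point_N_mem[of "xs - ?y x"] that active_row_at_xs[OF that]
      by (simp add: rows_null_space_def matrix_vector_mult_diff_distrib)
    have zf: "?y x + ?u x \<in> feasible A b"
      unfolding feasible_def
    proof (intro CollectI allI)
      fix i
      have "(A *v (?y x + ?u x)) $ i = (A *v ?y x) $ i + (A *v ?u x) $ i"
        by (simp only: matrix_vector_right_distrib vector_add_component)
      then show "(A *v (?y x + ?u x)) $ i \<le> b $ i"
        using Au[of i] elim(1) by (cases "i \<in> I") (simp, blast intro: less_imp_le)
    qed
    have Au_nonneg: "(A *v ?u x) $ i \<ge> 0" if "i \<in> I" for i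
      using Au[OF that] yf by (simp add: feasible_def)
    have sum_Au: "(\<Sum>i\<in>I. (A *v ?u x) $ i) = S (?y x)"
      unfolding slack_sum_def by (rule sum.cong) (auto simp: Au)
    have "norm (?u x) \<le> C * (\<Sum>i\<in>I. \<bar>(A *v ?u x) $ i\<bar>)"
      by (rule C(2)) (rule closest_point_subspace_orthogonal[OF subspace_rows_null_space])
    also have "(\<Sum>i\<in>I. \<bar>(A *v ?u x) $ i\<bar>) = S (?y x)"
      unfolding sum_Au[symmetric] using Au_nonneg by (intro sum.cong) auto
    finally have nu: "norm (?u x) \<le> C * S (?y x)" .
    have "S (?y x) = 0"
    proof (rule ccontr)
      assume "S (?y x) \<noteq> 0"
      then have Spos: "S (?y x) > 0" using slack_sum_nonneg[OF yf] by simp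
      have "?u x \<noteq> 0"
        using sum_Au Spos by fastforce
      have "\<alpha> * (g xs \<bullet> ?u x) \<le> \<alpha> * (- c * S (?y x))"
        using grad_inner_le[of "?u x"] Au_nonneg sum_Au \<alpha> by (intro mult_left_mono) auto
      moreover have "?w x \<bullet> ?u x \<le> 0"
        using gp_point_variational[OF zf, of x \<alpha> g] by (simp only: add_diff_cancel_left')
      moreover have "\<bar>(?w x - (- \<alpha> *\<^sub>R g xs)) \<bullet> ?u x\<bar> < \<alpha> * c * S (?y x)"
      proof -
        have "\<bar>(?w x - (- \<alpha> *\<^sub>R g xs)) \<bullet> ?u x\<bar> \<le> norm (?w x - (- \<alpha> *\<^sub>R g xs)) * norm (?u x)"
          by (rule Cauchy_Schwarz_ineq2)
        also have "\<dots> < \<alpha> * c / C * norm (?u x)"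
          using elim(2) \<open>?u x \<noteq> 0\<close> by (intro mult_strict_right_mono) (auto simp: dist_norm)
        also have "\<dots> \<le> \<alpha> * c / C * (C * S (?y x))"
          using nu \<alpha> c_pos C(1) by (intro mult_left_mono) auto
        finally show ?thesis using C(1) by simp
      qed
      moreover have "(?w x - (- \<alpha> *\<^sub>R g xs)) \<bullet> ?u x = ?w x \<bullet> ?u x + \<alpha> * (g xs \<bullet> ?u x)"
        by (simp add: inner_diff_left inner_add_left)
      ultimately show False by linarith
    qed
    with slack_sum_eq_0_iff[OF yf] elim(3) show ?case by blast
  qed
qed

text \<open>
  When the projection point has active set exactly \<open>I\<close>, small moves along \<open>N\<close> in both directions stay
  feasible, so the variational inequality becomes an equality: the residual
  \<open>x - \<alpha> g x - y\<close> is orthogonal to \<open>N\<close>.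
\<close>

lemma gp_dir_tangential:
  assumes act: "active A b (gp_point g A b x \<alpha>) = I"
  shows "closest_point N (gp_dir g A b \<alpha> x) = - \<alpha> *\<^sub>R closest_point N (g x)"
proof (rule closest_point_subspace_unique[OF subspace_rows_null_space])
  show "- \<alpha> *\<^sub>R closest_point N (g x) \<in> N"
    by (intro subspace_scale subspace_rows_null_space closest_point_N_mem)
  fix v assume v: "v \<in> N"
  let ?y = "gp_point g A b x \<alpha>"
  have yf: "?y \<in> feasible A b" using gp_point_feasible xs_feasible by blast
  have Av: "(A *v v) $ i = 0" if "i \<in> I" for i
    using v that by (simp add: rows_null_space_def)
  have "\<forall>\<^sub>F t in at_right 0. \<forall>i. (A *v (?y + t *\<^sub>R v)) $ i \<le> b $ i \<and> (A *v (?y - t *\<^sub>R v)) $ i \<le> b $ i"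
  proof (rule eventually_all_finite)
    fix i
    show "\<forall>\<^sub>F t in at_right 0. (A *v (?y + t *\<^sub>R v)) $ i \<le> b $ i \<and> (A *v (?y - t *\<^sub>R v)) $ i \<le> b $ i"
    proof (cases "i \<in> I")
      case True
      then show ?thesis
        using Av[OF True] yf by (simp add: feasible_def matrix_vector_right_distrib
            matrix_vector_mult_diff_distrib matrix_vector_mult_scaleR)
    next
      case False
      then have lt: "(A *v ?y) $ i < b $ i" using active_feasible_iff[OF yf] act by simp
      have "((\<lambda>t. (A *v ?y) $ i + t * (A *v v) $ i) \<longlongrightarrow> (A *v ?y) $ i + 0 * (A *v v) $ i) (at_right 0)"
        "((\<lambda>t. (A *v ?y) $ i - t * (A *v v) $ i) \<longlongrightarrow> (A *v ?y) $ i - 0 * (A *v v) $ i) (at_right 0)"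
        by (intro tendsto_intros)+
      then have "\<forall>\<^sub>F t in at_right 0. (A *v ?y) $ i + t * (A *v v) $ i < b $ i"
        "\<forall>\<^sub>F t in at_right 0. (A *v ?y) $ i - t * (A *v v) $ i < b $ i"
        using lt by (auto intro: order_tendstoD)
      then show ?thesis
        by eventually_elim
          (simp add: matrix_vector_right_distrib matrix_vector_mult_diff_distrib matrix_vector_mult_scaleR)
    qed
  qed
  moreover have "\<forall>\<^sub>F t::real in at_right 0. t > 0" by (simp add: eventually_at_right_less)
  ultimately have "\<forall>\<^sub>F t in at_right 0. t > 0 \<and>
      ?y + t *\<^sub>R v \<in> feasible A b \<and> ?y - t *\<^sub>R v \<in> feasible A b"
    by eventually_elim (simp add: feasible_def)
  then obtain t :: real where t: "t > 0" "?y + t *\<^sub>R v \<in> feasible A b" "?y - t *\<^sub>R v \<in> feasible A b"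
    using eventually_happens'[OF trivial_limit_at_right_real] by blast
  have "(x - \<alpha> *\<^sub>R g x - ?y) \<bullet> v = 0"
    using gp_point_variational[OF t(2), of x \<alpha> g] gp_point_variational[OF t(3), of x \<alpha> g] t(1)
    by (simp add: mult_le_0_iff zero_le_mult_iff)
  moreover have "(g x - closest_point N (g x)) \<bullet> v = 0"
    by (rule closest_point_subspace_orthogonal[OF subspace_rows_null_space v])
  ultimately show "(gp_dir g A b \<alpha> x - (- \<alpha> *\<^sub>R closest_point N (g x))) \<bullet> v = 0"
    by (simp add: gp_dir_def inner_diff_left inner_add_left)
qed

lemma gp_dir_rows:
  assumes "active A b (gp_point g A b x \<alpha>) = I" and "i \<in> I"
  shows "(A *v gp_dir g A b \<alpha> x) $ i = b $ i - (A *v x) $ i"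
proof -
  have "(A *v gp_point g A b x \<alpha>) $ i = b $ i" using assms by (auto simp: active_def)
  then show ?thesis by (simp add: gp_dir_def matrix_vector_mult_diff_distrib)
qed

lemma norm_gp_dir_le:
  obtains C where "C > 0"
    "\<And>x \<alpha>. \<alpha> \<ge> 0 \<Longrightarrow> x \<in> feasible A b \<Longrightarrow> active A b (gp_point g A b x \<alpha>) = I \<Longrightarrow>
       norm (gp_dir g A b \<alpha> x) \<le> C * S x + \<alpha> * norm (closest_point N (g x))"
proof -
  obtain C where C: "C > 0"
    "\<And>v. (\<And>u. u \<in> N \<Longrightarrow> v \<bullet> u = 0) \<Longrightarrow> norm v \<le> C * (\<Sum>i\<in>I. \<bar>(A *v v) $ i\<bar>)"
    using norm_le_rows_on_orthogonal_complement[of A I] by blast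
  have "norm (gp_dir g A b \<alpha> x) \<le> C * S x + \<alpha> * norm (closest_point N (g x))"
    if \<alpha>: "\<alpha> \<ge> 0" and x: "x \<in> feasible A b" and act: "active A b (gp_point g A b x \<alpha>) = I" for x \<alpha>
  proof -
    let ?d = "gp_dir g A b \<alpha> x" and ?t = "closest_point N (gp_dir g A b \<alpha> x)"
    have "norm ?d \<le> norm (?d - ?t) + norm ?t"
      using norm_triangle_ineq[of "?d - ?t" ?t] by simp
    moreover have "norm (?d - ?t) \<le> C * (\<Sum>i\<in>I. \<bar>(A *v (?d - ?t)) $ i\<bar>)"
      by (rule C(2)) (rule closest_point_subspace_orthogonal[OF subspace_rows_null_space])
    moreover have "(\<Sum>i\<in>I. \<bar>(A *v (?d - ?t)) $ i\<bar>) = S x"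
      unfolding slack_sum_def
    proof (rule sum.cong)
      fix i assume i: "i \<in> I"
      have "(A *v ?t) $ i = 0"
        using closest_point_N_mem[of ?d] i by (simp add: rows_null_space_def)
      then show "\<bar>(A *v (?d - ?t)) $ i\<bar> = b $ i - (A *v x) $ i"
        using gp_dir_rows[OF act i] x by (simp add: matrix_vector_mult_diff_distrib feasible_def)
    qed simp
    moreover have "norm ?t = \<alpha> * norm (closest_point N (g x))"
      using gp_dir_tangential[OF act] \<alpha> by simp
    ultimately show ?thesis by simp
  qed
  with C(1) show ?thesis using that by blast
qed

lemma norm_tangential_le_local_err:
  assumes "active A b x \<subseteq> I"
  shows "norm (closest_point N (g x)) \<le> local_err g A b x"
  unfolding local_err_def active_grad_def
  by (intro norm_closest_point_subspace_mono subspace_rows_null_space)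
    (use assms in \<open>auto simp: rows_null_space_def\<close>)

text \<open>
  With active set \<open>I\<close> there is no slack left, so the bound on the search direction reduces to the
  norm of the projected gradient.
\<close>

lemma eventually_global_err_le_local_err:
  "\<forall>\<^sub>F x in nhds xs. x \<in> feasible A b \<longrightarrow> active A b x = I \<longrightarrow>
     global_err g A b x \<le> local_err g A b x"
  using eventually_gp_point_active[of 1, simplified]
proof eventually_elim
  case (elim x)
  show ?case
  proof (intro impI)
    assume x: "x \<in> feasible A b" "active A b x = I"
    obtain C where
      "norm (gp_dir g A b 1 x) \<le> C * S x + 1 * norm (closest_point N (g x))"
      using norm_gp_dir_le elim x(1) by (metis zero_le_one)
    moreover have "S x = 0" using slack_sum_eq_0_iff[OF x(1)] x(2) by simp
    ultimately show "global_err g A b x \<le> local_err g A b x"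
      using norm_tangential_le_local_err[of x] x(2) by (simp add: global_err_def)
  qed
qed

text \<open>
  With \<open>t\<close> the norm of the projected gradient, the hypothesis gives
  \<open>t \<le> e x < \<theta> E x \<le> \<theta> (C S x + t)\<close>, and as \<open>\<theta> < 1\<close> the term \<open>\<theta> t\<close> can be absorbed on the left. The
  comparison of \<open>E\<close> with \<open>S\<close> needs the identification result for step length 1, the conclusion needs
  it for step length \<open>\<alpha>\<close>.
\<close>

lemma eventually_gp_dir_le_slack:
  assumes \<alpha>: "\<alpha> > 0" and \<theta>: "0 \<le> \<theta>" "\<theta> < 1"
  obtains C where "C > 0"
    "\<forall>\<^sub>F x in nhds xs. x \<in> feasible A b \<longrightarrow> local_err g A b x < \<theta> * global_err g A b x \<longrightarrow>
       norm (gp_dir g A b \<alpha> x) \<le> C * S x"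
proof -
  obtain C where C: "C > 0"
    "\<And>x \<alpha>. \<alpha> \<ge> 0 \<Longrightarrow> x \<in> feasible A b \<Longrightarrow> active A b (gp_point g A b x \<alpha>) = I \<Longrightarrow>
       norm (gp_dir g A b \<alpha> x) \<le> C * S x + \<alpha> * norm (closest_point N (g x))"
    using norm_gp_dir_le by blast
  let ?C = "C + \<alpha> * (C / (1 - \<theta>))"
  have "\<forall>\<^sub>F x in nhds xs. x \<in> feasible A b \<longrightarrow> local_err g A b x < \<theta> * global_err g A b x \<longrightarrow>
       norm (gp_dir g A b \<alpha> x) \<le> ?C * S x"
    using eventually_gp_point_active[of 1, simplified] eventually_gp_point_active[OF \<alpha>]
      eventually_active_subset[OF filterlim_ident]
  proof eventually_elim
    case (elim x)
    show ?case
    proof (intro impI)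
      assume x: "x \<in> feasible A b" and e: "local_err g A b x < \<theta> * global_err g A b x"
      let ?t = "norm (closest_point N (g x))"
      have S0: "C * S x \<ge> 0" using C(1) slack_sum_nonneg[OF x] by simp
      have "?t \<le> local_err g A b x" by (rule norm_tangential_le_local_err[OF elim(3)])
      also have "\<dots> \<le> \<theta> * (C * S x + 1 * ?t)"
        using e C(2)[OF zero_le_one x elim(1)] \<theta>(1)
        by (smt (verit) global_err_def mult_left_mono)
      also have "\<dots> \<le> C * S x + \<theta> * ?t"
        using mult_right_mono[of \<theta> 1 "C * S x"] \<theta> S0 by (simp add: algebra_simps)
      finally have "?t * (1 - \<theta>) \<le> C * S x" by (simp add: algebra_simps)
      then have "?t \<le> C / (1 - \<theta>) * S x" using \<theta> by (simp add: field_simps)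
      then have "\<alpha> * ?t \<le> \<alpha> * (C / (1 - \<theta>) * S x)" using \<alpha> by (intro mult_left_mono) auto
      then show "norm (gp_dir g A b \<alpha> x) \<le> ?C * S x"
        using C(2)[OF less_imp_le[OF \<alpha>] x elim(2)] by (simp add: algebra_simps)
    qed
  qed
  moreover have "?C > 0" using C(1) \<alpha> \<theta> by (intro add_pos_nonneg) auto
  ultimately show ?thesis using that by blast
qed

text \<open>
  Let \<open>G = g xs \<bullet> d\<close>, so \<open>G \<le> - c S x\<close>. On the segment from \<open>x\<close> to \<open>x + d\<close> the derivative of \<open>f\<close> along
  \<open>d\<close> differs from \<open>G\<close> by at most half of \<open>(1 - \<delta>) c S x\<close>, because the norm of \<open>d\<close> is of the order of
  \<open>S x\<close> and \<open>g\<close> is continuous at \<open>xs\<close>. One such half bounds the error in \<open>f (x + d) - f x\<close>, the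
  other one the error in \<open>\<delta> g x \<bullet> d\<close>, and together they are at most \<open>- (1 - \<delta>) G\<close>.
\<close>

lemma eventually_full_step:
  assumes grad: "\<And>z. GDERIV f z :> g z"
    and \<alpha>: "\<alpha> > 0" and \<delta>: "0 < \<delta>" "\<delta> < 1" and \<theta>: "0 \<le> \<theta>" "\<theta> < 1"
  shows "\<forall>\<^sub>F x in nhds xs. x \<in> feasible A b \<longrightarrow> local_err g A b x < \<theta> * global_err g A b x \<longrightarrow>
       armijo f g \<delta> x (gp_dir g A b \<alpha> x) 1"
proof -
  obtain C where C: "C > 0"
    "\<forall>\<^sub>F x in nhds xs. x \<in> feasible A b \<longrightarrow> local_err g A b x < \<theta> * global_err g A b x \<longrightarrow>
       norm (gp_dir g A b \<alpha> x) \<le> C * S x"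
    using eventually_gp_dir_le_slack[OF \<alpha> \<theta>] by blast
  let ?\<epsilon> = "(1 - \<delta>) * c / (2 * C)"
  have "?\<epsilon> > 0" using C(1) c_pos \<delta> by simp
  then have "\<forall>\<^sub>F x in nhds xs. dist (g x) (g xs) < ?\<epsilon>"
    by (rule tendstoD[OF tendsto_g])
  then obtain r where r: "r > 0" "\<And>x. dist x xs < r \<Longrightarrow> dist (g x) (g xs) < ?\<epsilon>"
    by (auto simp: eventually_nhds_metric)
  have "\<forall>\<^sub>F x in nhds xs. dist (gp_point g A b x \<alpha>) xs < r"
    using tendsto_gp_point[of \<alpha>] \<alpha> r(1) by (intro tendstoD) auto
  moreover have "\<forall>\<^sub>F x in nhds xs. dist x xs < r"
    using r(1) by (auto simp: eventually_nhds_metric)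
  ultimately show ?thesis
    using C(2) eventually_gp_point_active[OF \<alpha>]
  proof eventually_elim
    case (elim x)
    show ?case
    proof (intro impI)
      assume x: "x \<in> feasible A b" and e: "local_err g A b x < \<theta> * global_err g A b x"
      let ?d = "gp_dir g A b \<alpha> x"
      have nd: "norm ?d \<le> C * S x" using elim(3) x e by blast
      have close: "\<bar>(g z - g xs) \<bullet> ?d\<bar> \<le> (1 - \<delta>) * c / 2 * S x" if "dist z xs < r" for z
      proof -
        have "\<bar>(g z - g xs) \<bullet> ?d\<bar> \<le> norm (g z - g xs) * norm ?d" by (rule Cauchy_Schwarz_ineq2)
        also have "\<dots> \<le> ?\<epsilon> * (C * S x)"
          using r(2)[OF that] nd \<open>?\<epsilon> > 0\<close> by (intro mult_mono) (auto simp: dist_norm)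
        finally show ?thesis using C(1) by simp
      qed
      have "((\<lambda>t. f (x + t *\<^sub>R ?d)) has_real_derivative g (x + t *\<^sub>R ?d) \<bullet> ?d) (at t)" for t
      proof -
        have "((\<lambda>t. f (x + t *\<^sub>R ?d)) has_derivative (\<lambda>h. (h *\<^sub>R ?d) \<bullet> g (x + t *\<^sub>R ?d))) (at t)"
          using grad[of "x + t *\<^sub>R ?d"] unfolding gderiv_def
          by (rule has_derivative_compose[rotated]) (auto intro!: derivative_eq_intros)
        then show ?thesis
          unfolding has_field_derivative_def
          by (rule has_derivative_eq_rhs) (simp add: fun_eq_iff inner_commute)
      qed
      from MVT2[of 0 1, OF _ this] obtain s where s: "0 < s" "s < 1"
        "f (x + ?d) - f x = g (x + s *\<^sub>R ?d) \<bullet> ?d"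
        by auto
      have "x + s *\<^sub>R ?d = (1 - s) *\<^sub>R x + s *\<^sub>R gp_point g A b x \<alpha>"
        by (simp add: gp_dir_def algebra_simps)
      moreover have "(1 - s) *\<^sub>R x + s *\<^sub>R gp_point g A b x \<alpha> \<in> ball xs r"
        using elim(1,2) s(1,2)
        by (intro convexD[OF convex_ball]) (auto simp: dist_commute)
      ultimately have "dist (x + s *\<^sub>R ?d) xs < r" by (simp add: dist_commute)
      then have "\<bar>(g (x + s *\<^sub>R ?d) - g xs) \<bullet> ?d\<bar> \<le> (1 - \<delta>) * c / 2 * S x"
        by (rule close)
      then have 1: "f (x + ?d) - f x \<le> g xs \<bullet> ?d + (1 - \<delta>) * c / 2 * S x"
        unfolding inner_diff_left using s(3) by linarith
      have "\<delta> * \<bar>(g x - g xs) \<bullet> ?d\<bar> \<le> \<bar>(g x - g xs) \<bullet> ?d\<bar>"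
        using \<delta> by (simp add: mult_left_le_one_le)
      also have "\<dots> \<le> (1 - \<delta>) * c / 2 * S x" by (rule close[OF elim(2)])
      finally have "\<bar>\<delta> * ((g x - g xs) \<bullet> ?d)\<bar> \<le> (1 - \<delta>) * c / 2 * S x"
        using \<delta> by (simp add: abs_mult)
      then have 2: "\<delta> * (g x \<bullet> ?d) \<ge> \<delta> * (g xs \<bullet> ?d) - (1 - \<delta>) * c / 2 * S x"
        unfolding inner_diff_left right_diff_distrib by linarith
      have "(\<Sum>i\<in>I. (A *v ?d) $ i) = S x"
        unfolding slack_sum_def by (rule sum.cong) (auto simp: gp_dir_rows[OF elim(4)])
      then have "g xs \<bullet> ?d \<le> - c * S x"
        using grad_inner_le[of ?d] gp_dir_rows[OF elim(4)] x by (auto simp: feasible_def)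
      then have "(1 - \<delta>) * (g xs \<bullet> ?d) \<le> (1 - \<delta>) * (- c * S x)"
        using \<delta> by (intro mult_left_mono) auto
      then have 3: "g xs \<bullet> ?d - \<delta> * (g xs \<bullet> ?d) \<le> - 2 * ((1 - \<delta>) * c / 2 * S x)"
        by (simp add: algebra_simps)
      have "f (x + ?d) - f x \<le> \<delta> * (g x \<bullet> ?d)"
        using 1 2 3 by argo
      then show "armijo f g \<delta> x ?d 1" by (simp add: armijo_def)
    qed
  qed
qed

text \<open>
  Backtracking stops at the first trial step \<open>\<eta> ^ 0 = 1\<close>, which leads to the gradient projection point.
\<close>

lemma eventually_phase_one_lands_on_face:
  assumes grad: "\<And>z. GDERIV f z :> g z"
    and \<alpha>: "\<alpha> > 0" and \<delta>: "0 < \<delta>" "\<delta> < 1" and \<theta>: "0 \<le> \<theta>" "\<theta> < 1"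
  shows "\<forall>\<^sub>F x in nhds xs. \<forall>x'. x \<in> feasible A b \<longrightarrow>
       local_err g A b x < \<theta> * global_err g A b x \<longrightarrow>
       gpa_step f g A b \<delta> \<eta> \<alpha> x x' \<longrightarrow> active A b x' = I"
  using eventually_full_step[OF assms] eventually_gp_point_active[OF \<alpha>]
proof eventually_elim
  case (elim x)
  show ?case
  proof (intro allI impI)
    fix x'
    assume x: "x \<in> feasible A b" "local_err g A b x < \<theta> * global_err g A b x"
      and step: "gpa_step f g A b \<delta> \<eta> \<alpha> x x'"
    from step obtain j where j: "\<forall>i<j. \<not> armijo f g \<delta> x (gp_dir g A b \<alpha> x) (\<eta> ^ i)"
      "x' = x + (\<eta> ^ j) *\<^sub>R gp_dir g A b \<alpha> x"
      by (auto simp: gpa_step_def)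
    have "armijo f g \<delta> x (gp_dir g A b \<alpha> x) (\<eta> ^ 0)" using elim(1) x by simp
    with j(1) have "j = 0" by blast
    with j(2) have "x' = gp_point g A b x \<alpha>" by (simp add: gp_dir_def)
    with elim(2) show "active A b x' = I" by simp
  qed
qed

end

section \<open>Runs of the algorithm\<close>

lemma gpa_step_feasible:
  assumes x: "x \<in> feasible A b" and \<eta>: "0 \<le> \<eta>" "\<eta> \<le> 1"
    and step: "gpa_step f g A b \<delta> \<eta> \<alpha> x x'"
  shows "x' \<in> feasible A b"
proof -
  obtain j where "x' = x + (\<eta> ^ j) *\<^sub>R gp_dir g A b \<alpha> x" using step by (auto simp: gpa_step_def)
  then have "x' = (1 - \<eta> ^ j) *\<^sub>R x + (\<eta> ^ j) *\<^sub>R gp_point g A b x \<alpha>"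
    by (simp add: gp_dir_def algebra_simps)
  moreover have "gp_point g A b x \<alpha> \<in> feasible A b" using gp_point_feasible x by blast
  ultimately show ?thesis
    using x \<eta> by (auto intro!: convexD[OF convex_feasible] simp: power_le_one)
qed

context
  fixes f g A b lam \<delta> \<eta> \<alpha> \<beta> \<gamma> \<mu> \<theta>0 x \<theta> ph
  assumes run: "pasa_infinite_run f g A b lam \<delta> \<eta> \<alpha> \<beta> \<gamma> \<mu> 0 \<theta>0 x \<theta> ph"
begin

lemma run_phase_one:
  "k \<ge> 1 \<Longrightarrow> ph k = Phase_One \<Longrightarrow> phase_one_iteration f g A b lam \<delta> \<eta> \<alpha> \<beta> \<gamma> \<mu>
     (x k) (\<theta> k) (x (Suc k)) (\<theta> (Suc k)) (ph (Suc k))"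
  using run by (simp add: pasa_infinite_run_def)

lemma run_phase_two:
  "k \<ge> 1 \<Longrightarrow> ph k = Phase_Two \<Longrightarrow>
     phase_two_control g A b (\<theta> k) (x (Suc k)) (\<theta> (Suc k)) (ph (Suc k))"
  using run by (simp add: pasa_infinite_run_def)

lemma run_feasible:
  assumes "feasible A b \<noteq> {}" and "0 \<le> \<eta>" "\<eta> \<le> 1"
  shows "k \<ge> 1 \<Longrightarrow> x k \<in> feasible A b"
proof (induction k rule: dec_induct)
  case base
  then show ?case
    using run closest_point_in_set[OF closed_feasible assms(1)] by (simp add: pasa_infinite_run_def)
next
  case (step k)
  show ?case
  proof (cases "ph k")
    case Phase_One
    with run_phase_one step gpa_step_feasible assms show ?thesis
      by (metis phase_one_iteration_def)
  next
    case Phase_Two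
    with run step show ?thesis by (simp add: pasa_infinite_run_def lco_F1_def)
  qed
qed

lemma run_theta_bounds:
  assumes "0 < \<mu>" "\<mu> \<le> 1" "0 < \<theta>0"
  shows "k \<ge> 1 \<Longrightarrow> 0 < \<theta> k \<and> \<theta> k \<le> \<theta>0"
proof (induction k rule: dec_induct)
  case base
  then show ?case using run assms by (simp add: pasa_infinite_run_def)
next
  case (step k)
  have "\<theta> (Suc k) = \<theta> k \<or> \<theta> (Suc k) = \<mu> * \<theta> k"
    using run_phase_one run_phase_two step(1)
    by (cases "ph k") (auto simp: phase_one_iteration_def phase_two_control_def)
  moreover have "\<mu> * \<theta> k \<le> \<theta> k" using assms step(3) by (simp add: mult_left_le_one_le)
  ultimately show ?case using step(3) assms by (smt (verit) mult_pos_pos)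
qed

text \<open>
  Both phases choose the next phase by the same test, with the value of \<open>\<theta>\<close> at the start of the next
  iteration. In particular every phase-one iterate except the first satisfies \<open>e < \<theta> E\<close>, no matter
  which phase produced it.
\<close>

lemma run_phase_test:
  assumes "k \<ge> 1"
  shows "ph (Suc k) = Phase_One \<longleftrightarrow>
    local_err g A b (x (Suc k)) < \<theta> (Suc k) * global_err g A b (x (Suc k))"
  using run_phase_one[OF assms] run_phase_two[OF assms]
  by (cases "ph k") (auto simp: phase_one_iteration_def phase_two_control_def not_less)

end

theorem theorem5p1:
  fixes f :: "real^'n \<Rightarrow> real" and g :: "real^'n \<Rightarrow> real^'n"
    and A :: "real^'n^'m" and b :: "real^'m"
    and lam :: "real^'n \<Rightarrow> real^'m"
    and \<delta> \<eta> \<alpha> \<beta> \<gamma> \<mu> \<theta>0 :: real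
    and x :: "nat \<Rightarrow> real^'n" and \<theta> :: "nat \<Rightarrow> real" and ph :: "nat \<Rightarrow> phase"
    and xs :: "real^'n"
  assumes gradient: "\<And>z. GDERIV f z :> g z" and cont: "continuous_on UNIV g"
    and nonempty: "feasible A b \<noteq> {}"
    and params: "\<delta> \<in> {0<..<1}" "\<eta> \<in> {0<..<1}" "\<alpha> \<in> {0<..}" "\<beta> \<in> {1<..<2}" "\<gamma> \<in> {0<..<1}"
      "\<mu> \<in> {0<..<1}" "\<theta>0 \<in> {0<..<1}"
    and lam: "multiplier_selection g A b lam"
    and run: "pasa_infinite_run f g A b lam \<delta> \<eta> \<alpha> \<beta> \<gamma> \<mu> 0 \<theta>0 x \<theta> ph"
    and lim: "x \<longlonglongrightarrow> xs"
    and stat: "stationary g A b xs" and nondeg: "nondegenerate g A b xs"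
  shows "\<exists>K\<ge>1. \<forall>k\<ge>K. ph k = Phase_Two"
proof -
  have "lam xs \<in> multipliers g A b xs"
    using lam stat gp_point_stationary[OF stat zero_le_one]
    by (auto simp: multiplier_selection_def multipliers_def stationary_def)
  moreover from nondeg obtain c where
    "c > 0" "\<forall>i \<in> active A b xs. \<forall>l \<in> multipliers g A b xs. l $ i > c"
    unfolding nondegenerate_def by blast
  ultimately interpret strictly_complementary_point g A b xs "lam xs" c
    using cont stat by unfold_locales (auto intro: less_imp_le)
  have feas: "x k \<in> feasible A b" if "k \<ge> 1" for k
    using run_feasible[OF run nonempty _ _ that] params by simp
  have \<theta>: "0 < \<theta> k \<and> \<theta> k \<le> \<theta>0" if "k \<ge> 1" for k
    using run_theta_bounds[OF run _ _ _ that] params by simp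
  have E_pos: "global_err g A b (x k) > 0" if "k \<ge> 1" for k
    using run that by (simp add: pasa_infinite_run_def)
  have "\<forall>\<^sub>F k in sequentially.
      (\<forall>x'. x k \<in> feasible A b \<longrightarrow> local_err g A b (x k) < \<theta>0 * global_err g A b (x k) \<longrightarrow>
        gpa_step f g A b \<delta> \<eta> \<alpha> (x k) x' \<longrightarrow> active A b x' = I) \<and>
      (x k \<in> feasible A b \<longrightarrow> active A b (x k) = I \<longrightarrow>
        global_err g A b (x k) \<le> local_err g A b (x k)) \<and>
      active A b (x k) \<subseteq> I"
    using params
    by (intro eventually_conj eventually_active_subset[OF lim]
        eventually_compose_filterlim[OF _ lim] eventually_global_err_le_local_err
        eventually_phase_one_lands_on_face gradient) auto
  then obtain M where M: "\<And>k. k \<ge> M \<Longrightarrow>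
      (\<forall>x'. x k \<in> feasible A b \<longrightarrow> local_err g A b (x k) < \<theta>0 * global_err g A b (x k) \<longrightarrow>
        gpa_step f g A b \<delta> \<eta> \<alpha> (x k) x' \<longrightarrow> active A b x' = I) \<and>
      (x k \<in> feasible A b \<longrightarrow> active A b (x k) = I \<longrightarrow>
        global_err g A b (x k) \<le> local_err g A b (x k)) \<and>
      active A b (x k) \<subseteq> I"
    by (auto simp: eventually_sequentially)
  have F2: "active A b (x k) \<subseteq> active A b (x (Suc k))" if "k \<ge> 1" "ph k = Phase_Two" for k
    using run that by (simp add: pasa_infinite_run_def lco_F2_def)
  \<comment> \<open>The first iteration is in phase one without any test, so the argument starts at 2.\<close>
  define K where "K = max M 2"
  have two_if_face: "ph (Suc k) = Phase_Two" if k: "k \<ge> K" and "active A b (x (Suc k)) = I" for k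
  proof -
    have "\<theta> (Suc k) * global_err g A b (x (Suc k)) < 1 * global_err g A b (x (Suc k))"
      using \<theta>[of "Suc k"] E_pos[of "Suc k"] params by (intro mult_strict_right_mono) auto
    also have "\<dots> \<le> local_err g A b (x (Suc k))"
      using M[of "Suc k"] feas[of "Suc k"] k that(2) by (auto simp: K_def)
    finally have "ph (Suc k) \<noteq> Phase_One"
      using run_phase_test[OF run, of k] k by (simp add: K_def)
    then show ?thesis by (cases "ph (Suc k)") auto
  qed
  show ?thesis
  proof (cases "\<exists>k\<ge>K. ph k = Phase_One")
    case False
    then have "\<forall>k\<ge>K. ph k = Phase_Two" by (metis phase.exhaust)
    then show ?thesis by (intro exI[of _ K]) (simp add: K_def)
  next
    case True
    then obtain k where k: "k \<ge> K" "ph k = Phase_One" by blast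
    then have k1: "k \<ge> M" "k \<ge> 1" "k - 1 \<ge> 1" "Suc (k - 1) = k" by (auto simp: K_def)
    have "local_err g A b (x k) < \<theta> k * global_err g A b (x k)"
      using run_phase_test[OF run k1(3)] k(2) k1(4) by simp
    also have "\<dots> \<le> \<theta>0 * global_err g A b (x k)"
      using \<theta>[OF k1(2)] E_pos[OF k1(2)] by (intro mult_right_mono) auto
    finally have e: "local_err g A b (x k) < \<theta>0 * global_err g A b (x k)" .
    have "gpa_step f g A b \<delta> \<eta> \<alpha> (x k) (x (Suc k))"
      using run_phase_one[OF run k1(2) k(2)] by (simp add: phase_one_iteration_def)
    then have face: "active A b (x (Suc k)) = I"
      using M[OF k1(1)] feas[OF k1(2)] e by blast
    have "active A b (x j) = I \<and> ph j = Phase_Two" if "j \<ge> Suc k" for j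
      using that
    proof (induction j rule: dec_induct)
      case base
      show ?case using face two_if_face[OF k(1)] by simp
    next
      case (step j)
      then have j: "j \<ge> K" "j \<ge> 1" "Suc j \<ge> M" using k(1) by (auto simp: K_def)
      have "I \<subseteq> active A b (x (Suc j))" using F2[OF j(2)] step by simp
      then have "active A b (x (Suc j)) = I" using M[OF j(3)] by blast
      with two_if_face[OF j(1)] show ?case by simp
    qed
    then show ?thesis by (intro exI[of _ "Suc k"]) auto
  qed
qed

end
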